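(* For every $x\in\mathcal{R}$ and for every $q\in\mathbb{Q}$, each of the following subsets of the Levi-Civita field $\mathcal{R}$ is not measurable: (1) $\{y\in\mathcal{R}:\lambda(x-y)>q\}$; (2) $\{y\in\mathcal{R}:\lambda(x-y)\geq q\}$; (3) $\{y\in\mathcal{R}:\lambda(x-y)<q\}$; (4) $\{y\in\mathcal{R}:\lambda(x-y)\leq q\}$; (5) $\{y\in\mathcal{R}:\lambda(x-y)=q\}$.
   Context: A set $F\subset\mathbb{Q}$ is left-finite if $\{x\in F: x\le q\}$ is finite for every $q\in\mathbb{Q}$. The Levi-Civita field $\mathcal{R}$ is the set of functions $x:\mathbb{Q}\to\mathbb{R}$ (values written $x[q]$) whose support $\{q: x[q]\neq 0\}$ is left-finite, with pointwise sum and product $(x\cdot y)[q]=\sum_{q_1+q_2=q}x[q_1]y[q_2]$. For $x\ne 0$, $\lambda(x)=\min\operatorname{supp}(x)$, and $\lambda(0)=\infty$. For $x\neq y$, $x<y$ iff $(x-y)[\lambda(x-y)]<0$. This makes $\mathcal{R}$ an ordered field containing $\mathbb{R}$. A sequence strongly converges to $l$ if for every $\varepsilon\in\mathcal{R}$, $\varepsilon>0$, eventually $|a_n-l|<\varepsilon$; series are strong limits of partial sums unless otherwise stated. For $a\le b$ in $\mathcal{R}$, $I(a,b)$ denotes any of the four intervals (open, closed, half-open) of $\mathcal{R}$ with endpoints $a,b$ (degenerate intervals of length $0$ are allowed), with length $l(I(a,b))=b-a$. A set $A\subseteq\mathcal{R}$ is measurable iff for every $\varepsilon\in\mathcal{R}$,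 $\varepsilon>0$, there are two sequences of mutually disjoint intervals $\{I_n\}_{n\in\mathbb{N}}$, $\{J_n\}_{n\in\mathbb{N}}$ such that $\bigcup_n I_n\subseteq A\subseteq\bigcup_n J_n$, $\sum_n l(I_n)$ and $\sum_n l(J_n)$ strongly converge in $\mathcal{R}$, and $\sum_n l(J_n)-\sum_n l(I_n)\le\varepsilon$. *)

theory Defs
  imports Complex_Main "HOL-Library.Extended" "HOL-Library.Disjoint_Sets"
begin

section \<open>The Levi-Civita field\<close>

definition left_finite :: "rat set \<Rightarrow> bool" where
  "left_finite F \<longleftrightarrow> (\<forall>q. finite {x \<in> F. x \<le> q})"

lemma left_finite_subset: "left_finite B \<Longrightarrow> A \<subseteq> B \<Longrightarrow> left_finite A"
  unfolding left_finite_def by (intro allI, rule finite_subset[rotated], erule spec) auto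

lemma left_finite_Un: "left_finite A \<Longrightarrow> left_finite B \<Longrightarrow> left_finite (A \<union> B)"
proof -
  assume a: "left_finite A" "left_finite B"
  have "{x \<in> A \<union> B. x \<le> q} = {x \<in> A. x \<le> q} \<union> {x \<in> B. x \<le> q}" for q by auto
  with a show ?thesis unfolding left_finite_def by simp
qed

lemma left_finite_finite: "finite A \<Longrightarrow> left_finite A"
  unfolding left_finite_def by simp

lemma left_finite_min:
  assumes "left_finite A" "A \<noteq> {}"
  shows "\<exists>m\<in>A. \<forall>x\<in>A. m \<le> x"
proof -
  from assms obtain a where a: "a \<in> A" by auto
  let ?S = "{x \<in> A. x \<le> a}"
  have f: "finite ?S" and ne: "a \<in> ?S" using assms a unfolding left_finite_def by auto
  have 1: "Min ?S \<in> A" using Min_in[OF f] ne by blast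
  have 2: "Min ?S \<le> x" if "x \<in> A" for x
  proof (cases "x \<le> a")
    case True then show ?thesis using that f by simp
  next
    case False
    have "Min ?S \<le> a" using f ne by (rule Min_le)
    with False show ?thesis by simp
  qed
  show ?thesis using 1 2 by (intro bexI[of _ "Min ?S"] ballI)
qed

lemma left_finite_bdd:
  assumes "left_finite A"
  shows "\<exists>m. \<forall>x\<in>A. m \<le> x"
  using left_finite_min[OF assms] by (cases "A = {}") auto

lemma left_finite_pairs:
  assumes "left_finite A" "left_finite B"
  shows "finite {(a, b). a \<in> A \<and> b \<in> B \<and> a + b \<le> q}"
proof -
  obtain m where m: "\<And>x. x \<in> A \<Longrightarrow> m \<le> x" using left_finite_bdd[OF assms(1)] by auto
  obtain n where n: "\<And>x. x \<in> B \<Longrightarrow> n \<le> x" using left_finite_bdd[OF assms(2)] by auto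
  have "{(a, b). a \<in> A \<and> b \<in> B \<and> a + b \<le> q} \<subseteq> {x \<in> A. x \<le> q - n} \<times> {x \<in> B. x \<le> q - m}"
  proof safe
    fix a b assume *: "a \<in> A" "b \<in> B" "a + b \<le> q"
    show "a \<le> q - n" "b \<le> q - m" using m[OF *(1)] n[OF *(2)] *(3) by linarith+
  qed
  with assms show ?thesis unfolding left_finite_def by (meson finite_SigmaI finite_subset)
qed

lemma left_finite_sumset:
  assumes "left_finite A" "left_finite B"
  shows "left_finite {a + b |a b. a \<in> A \<and> b \<in> B}"
  unfolding left_finite_def
proof
  fix q
  have "{x \<in> {a + b |a b. a \<in> A \<and> b \<in> B}. x \<le> q}
      \<subseteq> (\<lambda>(a, b). a + b) ` {(a, b). a \<in> A \<and> b \<in> B \<and> a + b \<le> q}" by force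
  then show "finite {x \<in> {a + b |a b. a \<in> A \<and> b \<in> B}. x \<le> q}"
    by (rule finite_subset) (rule finite_imageI[OF left_finite_pairs[OF assms]])
qed

typedef levi_civita = "{x :: rat \<Rightarrow> real. left_finite {q. x q \<noteq> 0}}"
  morphisms coeff Levi_Civita
  by (rule exI[of _ "\<lambda>_. 0"]) (simp add: left_finite_def)

setup_lifting type_definition_levi_civita

lemma left_finite_supp [simp]: "left_finite {q. coeff x q \<noteq> 0}"
  using coeff[of x] by simp

lemma levi_civita_eqI: "(\<And>q. coeff x q = coeff y q) \<Longrightarrow> x = y"
  by (simp add: coeff_inject[symmetric] fun_eq_iff)

instantiation levi_civita :: ab_group_add
begin

lift_definition zero_levi_civita :: levi_civita is "\<lambda>_. 0"
  by (simp add: left_finite_def)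

lift_definition plus_levi_civita :: "levi_civita \<Rightarrow> levi_civita \<Rightarrow> levi_civita"
  is "\<lambda>x y q. x q + y q"
  by (erule left_finite_subset[OF left_finite_Un]) auto

lift_definition uminus_levi_civita :: "levi_civita \<Rightarrow> levi_civita" is "\<lambda>x q. - x q"
  by simp

lift_definition minus_levi_civita :: "levi_civita \<Rightarrow> levi_civita \<Rightarrow> levi_civita"
  is "\<lambda>x y q. x q - y q"
  by (erule left_finite_subset[OF left_finite_Un]) auto

instance by standard (transfer; simp add: algebra_simps fun_eq_iff)+

end

lemma coeff_simps [simp]:
  "coeff 0 q = 0" "coeff (x + y) q = coeff x q + coeff y q"
  "coeff (- x) q = - coeff x q" "coeff (x - y) q = coeff x q - coeff y q"
  by (transfer; simp)+

lemma coeff_sum [simp]: "coeff (sum f A) q = (\<Sum>i\<in>A. coeff (f i) q)"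
  by (induction A rule: infinite_finite_induct) auto

definition lambda :: "levi_civita \<Rightarrow> rat extended" where
  "lambda x = (if x = 0 then \<infinity> else Fin (LEAST q. coeff x q \<noteq> 0))"

lemma lambda_0 [simp]: "lambda 0 = \<infinity>"
  by (simp add: lambda_def)

lemma lambda_eq_Fin_iff: "lambda x = Fin q \<longleftrightarrow> coeff x q \<noteq> 0 \<and> (\<forall>p<q. coeff x p = 0)"
proof (cases "x = 0")
  case False
  then have "{q. coeff x q \<noteq> 0} \<noteq> {}" using levi_civita_eqI[of x 0] by auto
  then obtain m where m: "coeff x m \<noteq> 0" "\<And>p. coeff x p \<noteq> 0 \<Longrightarrow> m \<le> p"
    using left_finite_min[OF left_finite_supp[of x]] by auto
  have "(LEAST q. coeff x q \<noteq> 0) = m" by (rule Least_equality) (use m in auto)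
  then have l: "lambda x = Fin m" using False by (simp add: lambda_def)
  show ?thesis
  proof
    assume "lambda x = Fin q"
    with l have "q = m" by simp
    with m show "coeff x q \<noteq> 0 \<and> (\<forall>p<q. coeff x p = 0)" using leD by blast
  next
    assume a: "coeff x q \<noteq> 0 \<and> (\<forall>p<q. coeff x p = 0)"
    then have "m \<le> q" "\<not> m < q" using m by auto
    with l show "lambda x = Fin q" by simp
  qed
qed (simp add: lambda_def)

lemma lambda_cases: "x = 0 \<or> (\<exists>q. lambda x = Fin q)"
  by (simp add: lambda_def)

instantiation levi_civita :: times
begin

text \<open>The index set of the sum is finite because the supports are left-finite.\<close>

lift_definition times_levi_civita :: "levi_civita \<Rightarrow> levi_civita \<Rightarrow> levi_civita" is
  "\<lambda>x y q. \<Sum>(q1, q2) | q1 + q2 = q \<and> x q1 \<noteq> 0 \<and> y q2 \<noteq> 0. x q1 * y q2"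
proof -
  fix x y :: "rat \<Rightarrow> real"
  assume a: "left_finite {q. x q \<noteq> 0}" "left_finite {q. y q \<noteq> 0}"
  show "left_finite {q. (\<Sum>(q1, q2) | q1 + q2 = q \<and> x q1 \<noteq> 0 \<and> y q2 \<noteq> 0. x q1 * y q2) \<noteq> 0}"
  proof (rule left_finite_subset[OF left_finite_sumset[OF a]], rule subsetI)
    fix q assume "q \<in> {q. (\<Sum>(q1, q2) | q1 + q2 = q \<and> x q1 \<noteq> 0 \<and> y q2 \<noteq> 0. x q1 * y q2) \<noteq> 0}"
    then have "{(q1, q2). q1 + q2 = q \<and> x q1 \<noteq> 0 \<and> y q2 \<noteq> 0} \<noteq> {}"
      using sum.empty by force
    then show "q \<in> {a + b |a b. a \<in> {q. x q \<noteq> 0} \<and> b \<in> {q. y q \<noteq> 0}}" by auto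
  qed
qed

instance ..

end

lemma finite_pairs:
  assumes "left_finite A" "left_finite B"
  shows "finite {(a, b). a + b = q \<and> a \<in> A \<and> b \<in> B}"
  by (rule finite_subset[OF _ left_finite_pairs[OF assms, of q]]) auto

lemma coeff_mult:
  assumes "left_finite A" "left_finite B"
    and "{q. coeff x q \<noteq> 0} \<subseteq> A" "{q. coeff y q \<noteq> 0} \<subseteq> B"
  shows "coeff (x * y) q = (\<Sum>(a, b) | a + b = q \<and> a \<in> A \<and> b \<in> B. coeff x a * coeff y b)"
proof -
  have "coeff (x * y) q
      = (\<Sum>(a, b) | a + b = q \<and> coeff x a \<noteq> 0 \<and> coeff y b \<noteq> 0. coeff x a * coeff y b)"
    by transfer simp
  also have "\<dots> = (\<Sum>(a, b) | a + b = q \<and> a \<in> A \<and> b \<in> B. coeff x a * coeff y b)"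
    by (rule sum.mono_neutral_left[OF finite_pairs[OF assms(1,2)]]) (use assms(3,4) in auto)
  finally show ?thesis .
qed

lemma lc_mult_commute: "x * y = y * (x :: levi_civita)"
proof (rule levi_civita_eqI)
  fix q
  have "coeff (x * y) q
      = (\<Sum>(a, b) | a + b = q \<and> a \<in> {q. coeff x q \<noteq> 0} \<and> b \<in> {q. coeff y q \<noteq> 0}. coeff x a * coeff y b)"
    by (rule coeff_mult) auto
  also have "\<dots> = (\<Sum>(a, b) | a + b = q \<and> a \<in> {q. coeff y q \<noteq> 0} \<and> b \<in> {q. coeff x q \<noteq> 0}. coeff y a * coeff x b)"
    by (rule sum.reindex_bij_witness[where i = "\<lambda>(a, b). (b, a)" and j = "\<lambda>(a, b). (b, a)"]) auto
  also have "\<dots> = coeff (y * x) q"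
    by (rule coeff_mult[symmetric]) auto
  finally show "coeff (x * y) q = coeff (y * x) q" .
qed

lemma coeff_mult3:
  "coeff (x * y * z) q = (\<Sum>(a, b, c) | a + b + c = q \<and> coeff x a \<noteq> 0 \<and> coeff y b \<noteq> 0 \<and> coeff z c \<noteq> 0.
     coeff x a * coeff y b * coeff z c)"
proof -
  let ?X = "{q. coeff x q \<noteq> 0}" and ?Y = "{q. coeff y q \<noteq> 0}" and ?Z = "{q. coeff z q \<noteq> 0}"
  let ?S = "{a + b |a b. a \<in> ?X \<and> b \<in> ?Y}"
  let ?P = "\<lambda>r. {(a, b). a + b = r \<and> a \<in> ?X \<and> b \<in> ?Y}"
  let ?Q = "{(r, c). r + c = q \<and> r \<in> ?S \<and> c \<in> ?Z}"
  have S: "left_finite ?S" by (rule left_finite_sumset) simp_all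
  have xy: "coeff (x * y) r = (\<Sum>(a, b)\<in>?P r. coeff x a * coeff y b)" for r
    by (rule coeff_mult) auto
  have ne: "{r. coeff (x * y) r \<noteq> 0} \<subseteq> ?S"
  proof (rule subsetI, rule ccontr)
    fix r assume r: "r \<in> {r. coeff (x * y) r \<noteq> 0}" "r \<notin> ?S"
    then have "?P r = {}" by blast
    with xy[of r] r(1) show False by (simp only: sum.empty mem_Collect_eq simp_thms)
  qed
  have "coeff (x * y * z) q = (\<Sum>(r, c)\<in>?Q. coeff (x * y) r * coeff z c)"
    by (rule coeff_mult[OF S left_finite_supp ne order_refl])
  also have "\<dots> = (\<Sum>u\<in>?Q. \<Sum>v\<in>?P (fst u). coeff x (fst v) * coeff y (snd v) * coeff z (snd u))"
    unfolding xy by (simp add: sum_distrib_right case_prod_unfold)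
  also have "\<dots> = (\<Sum>(u, v)\<in>Sigma ?Q (\<lambda>u. ?P (fst u)). coeff x (fst v) * coeff y (snd v) * coeff z (snd u))"
    by (rule sum.Sigma) (use finite_pairs[OF S left_finite_supp] finite_pairs[OF left_finite_supp left_finite_supp] in auto)
  also have "\<dots> = (\<Sum>(a, b, c) | a + b + c = q \<and> coeff x a \<noteq> 0 \<and> coeff y b \<noteq> 0 \<and> coeff z c \<noteq> 0.
     coeff x a * coeff y b * coeff z c)"
    by (rule sum.reindex_bij_witness[where j = "\<lambda>((r, c), (a, b)). (a, b, c)"
          and i = "\<lambda>(a, b, c). ((a + b, c), (a, b))"]) auto
  finally show ?thesis .
qed

instantiation levi_civita :: comm_ring_1
begin

lift_definition one_levi_civita :: levi_civita is "\<lambda>q. if q = 0 then 1 else 0"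
  by (rule left_finite_finite) simp

instance
proof
  fix x y z :: levi_civita
  show "x * y = y * x" by (rule lc_mult_commute)
  show "x * y * z = x * (y * z)"
  proof (rule levi_civita_eqI)
    fix q
    have "coeff (x * y * z) q = coeff (y * z * x) q"
      unfolding coeff_mult3
      by (rule sum.reindex_bij_witness[where i = "\<lambda>(b, c, a). (a, b, c)" and j = "\<lambda>(a, b, c). (b, c, a)"])
         (auto simp: algebra_simps)
    then show "coeff (x * y * z) q = coeff (x * (y * z)) q" by (simp add: lc_mult_commute)
  qed
  show "(x + y) * z = x * z + y * z"
  proof (rule levi_civita_eqI)
    fix q
    let ?A = "{q. coeff x q \<noteq> 0} \<union> {q. coeff y q \<noteq> 0}" and ?B = "{q. coeff z q \<noteq> 0}"
    have A: "left_finite ?A" by (rule left_finite_Un) simp_all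
    let ?P = "{(a, b). a + b = q \<and> a \<in> ?A \<and> b \<in> ?B}"
    have w: "coeff (w * z) q = (\<Sum>(a, b)\<in>?P. coeff w a * coeff z b)"
      if "{q. coeff w q \<noteq> 0} \<subseteq> ?A" for w
      by (rule coeff_mult[OF A left_finite_supp that order_refl])
    have "coeff ((x + y) * z) q = (\<Sum>u\<in>?P. coeff (x + y) (fst u) * coeff z (snd u))"
      by (subst w) (auto simp: case_prod_unfold)
    also have "\<dots> = (\<Sum>u\<in>?P. coeff x (fst u) * coeff z (snd u)) + (\<Sum>u\<in>?P. coeff y (fst u) * coeff z (snd u))"
      unfolding sum.distrib[symmetric] by (rule sum.cong[OF refl]) (simp add: distrib_right)
    also have "\<dots> = coeff (x * z) q + coeff (y * z) q"
      unfolding w[OF Un_upper1] w[OF Un_upper2] by (simp only: case_prod_unfold)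
    finally show "coeff ((x + y) * z) q = coeff (x * z + y * z) q" by simp
  qed
  show "1 * x = x"
  proof (rule levi_civita_eqI)
    fix q
    let ?B = "insert q {q. coeff x q \<noteq> 0}"
    have B: "left_finite ?B"
      using left_finite_Un[OF left_finite_finite[of "{q}"] left_finite_supp[of x]] by simp
    have "coeff (1 * x) q = (\<Sum>(a, b) | a + b = q \<and> a \<in> {0} \<and> b \<in> ?B. coeff 1 a * coeff x b)"
      by (rule coeff_mult[OF left_finite_finite B]) (auto simp: one_levi_civita.rep_eq)
    also have "{(a, b). a + b = q \<and> a \<in> {0} \<and> b \<in> ?B} = {(0, q)}" by auto
    finally show "coeff (1 * x) q = coeff x q" by (simp add: one_levi_civita.rep_eq)
  qed
  show "(0 :: levi_civita) \<noteq> 1"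
    using one_levi_civita.rep_eq by (metis coeff_simps(1) zero_neq_one)
qed

end

lemma coeff_1 [simp]: "coeff 1 q = (if q = 0 then 1 else 0)"
  by (rule one_levi_civita.rep_eq[THEN fun_cong])

lemma coeff_mult_bound:
  assumes "\<And>a. a < p \<Longrightarrow> coeff x a = 0" "\<And>b. b < r \<Longrightarrow> coeff y b = 0"
  shows "q < p + r \<Longrightarrow> coeff (x * y) q = 0"
    and "coeff (x * y) (p + r) = coeff x p * coeff y r"
proof -
  let ?A = "{q. coeff x q \<noteq> 0}" and ?B = "{q. coeff y q \<noteq> 0}"
  have A: "p \<le> a" if "a \<in> ?A" for a using that assms(1)[of a] by force
  have B: "r \<le> b" if "b \<in> ?B" for b using that assms(2)[of b] by force
  have m: "coeff (x * y) q = (\<Sum>(a, b) | a + b = q \<and> a \<in> ?A \<and> b \<in> ?B. coeff x a * coeff y b)" for q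
    by (rule coeff_mult) auto
  show "coeff (x * y) q = 0" if "q < p + r"
  proof -
    have "{(a, b). a + b = q \<and> a \<in> ?A \<and> b \<in> ?B} = {}"
    proof (rule ccontr)
      assume "\<not> ?thesis"
      then obtain a b where "a + b = q" "a \<in> ?A" "b \<in> ?B" by blast
      with A[of a] B[of b] that show False by linarith
    qed
    with m[of q] show ?thesis by (simp only: sum.empty)
  qed
  have m': "coeff (x * y) (p + r)
      = (\<Sum>(a, b) | a + b = p + r \<and> a \<in> insert p ?A \<and> b \<in> insert r ?B. coeff x a * coeff y b)"
    by (rule coeff_mult)
       (use left_finite_Un[OF left_finite_finite[of "{_}"] left_finite_supp] in auto)
  have "{(a, b). a + b = p + r \<and> a \<in> insert p ?A \<and> b \<in> insert r ?B} = {(p, r)}"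
  proof (rule set_eqI, rule iffI)
    fix u assume "u \<in> {(a, b). a + b = p + r \<and> a \<in> insert p ?A \<and> b \<in> insert r ?B}"
    then obtain a b where u: "u = (a, b)" "a + b = p + r" "a \<in> insert p ?A" "b \<in> insert r ?B"
      by blast
    have "p \<le> a" "r \<le> b" using u A[of a] B[of b] by auto
    with u(2) have "a = p" "b = r" by linarith+
    with u(1) show "u \<in> {(p, r)}" by simp
  qed auto
  with m' show "coeff (x * y) (p + r) = coeff x p * coeff y r" by simp
qed

lemma lambda_mult:
  assumes "lambda x = Fin p" "lambda y = Fin r"
  shows "lambda (x * y) = Fin (p + r)" "coeff (x * y) (p + r) = coeff x p * coeff y r"
  using coeff_mult_bound[of p x r y] assms by (auto simp: lambda_eq_Fin_iff)

lemma lc_no_zero_divisors: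
  assumes "x \<noteq> 0" "y \<noteq> (0 :: levi_civita)"
  shows "x * y \<noteq> 0"
proof
  assume 0: "x * y = 0"
  from assms lambda_cases obtain p r where "lambda x = Fin p" "lambda y = Fin r" by meson
  from lambda_mult(1)[OF this] 0 show False by simp
qed

lift_definition lc_monom :: "real \<Rightarrow> rat \<Rightarrow> levi_civita" is "\<lambda>c p q. if q = p then c else 0"
  by (rule left_finite_finite, rule finite_subset[of _ "{_}"]) auto

lemma lc_inverse_exists_aux:
  assumes e: "e > 0" and u: "\<And>q. q < e \<Longrightarrow> coeff u q = 0"
  shows "\<exists>z. (1 - u) * z = 1"
proof -
  have pow: "coeff (u ^ n) q = 0" if "q < of_nat n * e" for n q
    using that
  proof (induction n arbitrary: q)
    case (Suc n)
    show ?case unfolding power_Suc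
      by (rule coeff_mult_bound(1)[of e u "of_nat n * e"]) (use u Suc in \<open>auto simp: algebra_simps\<close>)
  qed simp
  have ex: "\<exists>M. q < of_nat M * e" for q
    using reals_Archimedean3 ex_less_of_nat_mult[OF e] by blast
  define N where "N q = (LEAST M. q < of_nat M * e)" for q
  have N: "q < of_nat (N q) * e" for q
    unfolding N_def using ex by (rule LeastI_ex)
  have sums: "(\<Sum>n<M. coeff (u ^ n) q) = (\<Sum>n<N q. coeff (u ^ n) q)" if M: "q < of_nat M * e" for M q
  proof (rule sum.mono_neutral_right)
    show "{..<N q} \<subseteq> {..<M}" unfolding N_def using Least_le[of "\<lambda>M. q < of_nat M * e", OF M] by auto
    show "\<forall>i\<in>{..<M} - {..<N q}. coeff (u ^ i) q = 0"
    proof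
      fix i assume "i \<in> {..<M} - {..<N q}"
      then have "(of_nat (N q) :: rat) * e \<le> of_nat i * e" using e by (intro mult_right_mono) auto
      with N[of q] show "coeff (u ^ i) q = 0" by (intro pow) linarith
    qed
  qed simp
  define zf where "zf q = (\<Sum>n<N q. coeff (u ^ n) q)" for q
  have "left_finite {q. zf q \<noteq> 0}"
    unfolding left_finite_def
  proof
    fix r :: rat
    have "{x \<in> {q. zf q \<noteq> 0}. x \<le> r} \<subseteq> (\<Union>n<N r. {x \<in> {q. coeff (u ^ n) q \<noteq> 0}. x \<le> r})"
    proof
      fix q assume q: "q \<in> {x \<in> {q. zf q \<noteq> 0}. x \<le> r}"
      then have "q < of_nat (N r) * e" using N[of r] by simp
      from sums[OF this] q have "(\<Sum>n<N r. coeff (u ^ n) q) \<noteq> 0" by (simp add: zf_def)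
      then obtain n where "n < N r" "coeff (u ^ n) q \<noteq> 0"
        by (metis (no_types, lifting) lessThan_iff sum.neutral)
      with q show "q \<in> (\<Union>n<N r. {x \<in> {q. coeff (u ^ n) q \<noteq> 0}. x \<le> r})" by auto
    qed
    moreover have "finite (\<Union>n<N r. {x \<in> {q. coeff (u ^ n) q \<noteq> 0}. x \<le> r})"
      using left_finite_supp unfolding left_finite_def by blast
    ultimately show "finite {x \<in> {q. zf q \<noteq> 0}. x \<le> r}" by (rule finite_subset)
  qed
  then have z: "coeff (Levi_Civita zf) = zf" by (simp add: Levi_Civita_inverse)
  define z where "z = Levi_Civita zf"
  have "(1 - u) * z = 1"
  proof (rule levi_civita_eqI)
    fix q :: rat
    define r where "r = max q 0"
    define S where "S = (\<Sum>n<N r. u ^ n)"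
    have "coeff ((1 - u) * (z - S)) q = 0"
    proof (rule coeff_mult_bound(1)[where p = 0 and r = "of_nat (N r) * e"])
      show "coeff (1 - u) a = 0" if "a < 0" for a using that u[of a] e by simp
      show "coeff (z - S) b = 0" if "b < of_nat (N r) * e" for b
        using sums[OF that] z by (simp add: z_def S_def zf_def)
      show "q < 0 + of_nat (N r) * e" using N[of r] by (simp add: r_def)
    qed
    moreover have "(1 - u) * S = 1 - u ^ N r" by (simp add: S_def one_diff_power_eq)
    moreover have "coeff (u ^ N r) q = 0" using pow N[of r] by (simp add: r_def)
    ultimately show "coeff ((1 - u) * z) q = coeff 1 q" by (simp add: right_diff_distrib del: coeff_1)
  qed
  then show ?thesis ..
qed

lemma lc_inverse_exists:
  assumes "x \<noteq> (0 :: levi_civita)"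
  shows "\<exists>y. x * y = 1"
proof -
  from assms lambda_cases obtain p where p: "lambda x = Fin p" by meson
  define c where "c = coeff x p"
  have c: "c \<noteq> 0" using p by (simp add: lambda_eq_Fin_iff c_def)
  define m where "m = lc_monom (1 / c) (- p)"
  have m: "lambda m = Fin (- p)" "coeff m (- p) = 1 / c"
    using c by (auto simp: lambda_eq_Fin_iff m_def lc_monom.rep_eq)
  define u where "u = 1 - m * x"
  have mx: "lambda (m * x) = Fin 0" "coeff (m * x) 0 = 1"
    using lambda_mult[OF m(1) p] m(2) c by (simp_all add: c_def)
  have u0: "coeff u q = 0" if "q \<le> 0" for q
    using that mx by (cases "q = 0") (auto simp: u_def lambda_eq_Fin_iff)
  obtain e where "e > 0" "\<And>q. q < e \<Longrightarrow> coeff u q = 0"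
  proof (cases "u = 0")
    case True
    then show ?thesis using that[of 1] by simp
  next
    case False
    with lambda_cases obtain e where e: "lambda u = Fin e" by meson
    then have "e > 0" using u0[of e] by (force simp: lambda_eq_Fin_iff)
    with e show ?thesis using that[of e] by (simp add: lambda_eq_Fin_iff)
  qed
  from lc_inverse_exists_aux[OF this] obtain z where "(1 - u) * z = 1" by blast
  then have "x * (m * z) = 1" by (simp add: u_def mult_ac)
  then show ?thesis ..
qed

instantiation levi_civita :: inverse
begin

definition inverse_levi_civita :: "levi_civita \<Rightarrow> levi_civita" where
  "inverse_levi_civita x = (if x = 0 then 0 else THE y. x * y = 1)"

definition divide_levi_civita :: "levi_civita \<Rightarrow> levi_civita \<Rightarrow> levi_civita" where
  "divide_levi_civita x y = x * inverse y"

instance ..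

end

instance levi_civita :: field
proof
  fix x y :: levi_civita
  show "inverse x * x = 1" if "x \<noteq> 0"
  proof -
    obtain y where y: "x * y = 1" using lc_inverse_exists[OF \<open>x \<noteq> 0\<close>] ..
    have "z = y" if "x * z = 1" for z
    proof -
      have "z = y * (x * z)" using y by (simp add: mult.assoc[symmetric] mult.commute)
      also have "\<dots> = y" using that by simp
      finally show ?thesis .
    qed
    with y have "(THE y. x * y = 1) = y" by (rule the_equality)
    then have "inverse x = y" using that by (simp add: inverse_levi_civita_def)
    with y show ?thesis by (simp add: mult.commute)
  qed
  show "x div y = x * inverse y" by (rule divide_levi_civita_def)
  show "inverse (0 :: levi_civita) = 0" by (simp add: inverse_levi_civita_def)
qed

definition lc_neg :: "levi_civita \<Rightarrow> bool" where
  "lc_neg x \<longleftrightarrow> (\<exists>q. lambda x = Fin q \<and> coeff x q < 0)"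

lemma lc_neg_trichotomy: "x = 0 \<or> lc_neg x \<or> lc_neg (- x)"
proof -
  consider "x = 0" | q where "lambda x = Fin q" using lambda_cases by blast
  then show ?thesis
  proof cases
    case 2
    then have "lambda (- x) = Fin q" "coeff x q \<noteq> 0" by (auto simp: lambda_eq_Fin_iff)
    with 2 show ?thesis unfolding lc_neg_def by (metis coeff_simps(3) neg_less_0_iff_less linorder_neqE_linordered_idom)
  qed simp
qed

lemma lc_neg_add:
  assumes "lc_neg x" "lc_neg y"
  shows "lc_neg (x + y)"
proof -
  from assms obtain p r where p: "coeff x p < 0" "\<And>a. a < p \<Longrightarrow> coeff x a = 0"
    and r: "coeff y r < 0" "\<And>a. a < r \<Longrightarrow> coeff y a = 0"
    unfolding lc_neg_def lambda_eq_Fin_iff by blast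
  have "coeff (x + y) (min p r) < 0"
    using p(1) r(1) p(2)[of r] r(2)[of p] by (cases p r rule: linorder_cases) auto
  moreover have "coeff (x + y) a = 0" if "a < min p r" for a using that p r by simp
  ultimately show ?thesis unfolding lc_neg_def lambda_eq_Fin_iff
    by (intro exI[of _ "min p r"]) simp
qed

lemma not_lc_neg_0 [simp]: "\<not> lc_neg 0"
  by (simp add: lc_neg_def)

lemma lc_neg_mult:
  assumes "lc_neg x" "lc_neg (- y)"
  shows "lc_neg (x * y)"
proof -
  from assms obtain p r where p: "lambda x = Fin p" "coeff x p < 0"
    and r: "lambda (- y) = Fin r" "coeff (- y) r < 0"
    unfolding lc_neg_def by blast
  from r have "lambda y = Fin r" "coeff y r > 0" by (auto simp: lambda_eq_Fin_iff)
  with lambda_mult[OF p(1) this(1)] p show ?thesis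
    unfolding lc_neg_def by (auto simp: mult_neg_pos)
qed

instantiation levi_civita :: linordered_field
begin

definition less_levi_civita :: "levi_civita \<Rightarrow> levi_civita \<Rightarrow> bool" where
  "x < y \<longleftrightarrow> lc_neg (x - y)"

definition less_eq_levi_civita :: "levi_civita \<Rightarrow> levi_civita \<Rightarrow> bool" where
  "less_eq_levi_civita x y \<longleftrightarrow> x < y \<or> x = y"

definition abs_levi_civita :: "levi_civita \<Rightarrow> levi_civita" where
  "abs_levi_civita x = (if x < 0 then - x else x)"

definition sgn_levi_civita :: "levi_civita \<Rightarrow> levi_civita" where
  "sgn_levi_civita x = (if x = 0 then 0 else if 0 < x then 1 else - 1)"

instance
proof
  fix x y z :: levi_civita
  have tr: "a < c" if "a < b" "b < c" for a b c :: levi_civita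
    using lc_neg_add[of "a - b" "b - c"] that by (simp add: less_levi_civita_def)
  have irr: "\<not> a < a" for a :: levi_civita by (simp add: less_levi_civita_def)
  show "x < y \<longleftrightarrow> x \<le> y \<and> \<not> y \<le> x" using tr irr unfolding less_eq_levi_civita_def by metis
  show "x \<le> x" by (simp add: less_eq_levi_civita_def)
  show "x \<le> y \<Longrightarrow> y \<le> z \<Longrightarrow> x \<le> z" using tr unfolding less_eq_levi_civita_def by metis
  show "x \<le> y \<Longrightarrow> y \<le> x \<Longrightarrow> x = y" using tr irr unfolding less_eq_levi_civita_def by metis
  show "x \<le> y \<or> y \<le> x"
    using lc_neg_trichotomy[of "x - y"] by (auto simp: less_eq_levi_civita_def less_levi_civita_def)
  show "x \<le> y \<Longrightarrow> z + x \<le> z + y" by (auto simp: less_eq_levi_civita_def less_levi_civita_def)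
  show "x < y \<Longrightarrow> 0 < z \<Longrightarrow> z * x < z * y"
    using lc_neg_mult[of "x - y" z] by (simp add: less_levi_civita_def algebra_simps)
  show "\<bar>x\<bar> = (if x < 0 then - x else x)" by (rule abs_levi_civita_def)
  show "sgn x = (if x = 0 then 0 else if 0 < x then 1 else - 1)" by (rule sgn_levi_civita_def)
qed

end

section \<open>Strong convergence and measurability\<close>

definition strongly_converges :: "(nat \<Rightarrow> levi_civita) \<Rightarrow> levi_civita \<Rightarrow> bool" where
  "strongly_converges a l \<longleftrightarrow> (\<forall>\<epsilon>>0. \<exists>N. \<forall>n\<ge>N. \<bar>a n - l\<bar> < \<epsilon>)"

definition strongly_sums :: "(nat \<Rightarrow> levi_civita) \<Rightarrow> levi_civita \<Rightarrow> bool" where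
  "strongly_sums a s \<longleftrightarrow> strongly_converges (\<lambda>n. \<Sum>k<n. a k) s"

definition lc_interval :: "levi_civita \<Rightarrow> levi_civita \<Rightarrow> levi_civita set \<Rightarrow> bool" where
  "lc_interval a b I \<longleftrightarrow> a \<le> b \<and> I \<in> {{a<..<b}, {a..b}, {a..<b}, {a<..b}}"

text \<open>
  The interval \<open>I n\<close> carries its endpoints \<open>a n\<close>, \<open>b n\<close>, so its length is \<open>b n - a n\<close>
  (and likewise \<open>d n - c n\<close> for \<open>J n\<close>).
\<close>

definition lc_measurable :: "levi_civita set \<Rightarrow> bool" where
  "lc_measurable A \<longleftrightarrow> (\<forall>\<epsilon>>0. \<exists>a b I c d J s t.
     (\<forall>n. lc_interval (a n) (b n) (I n)) \<and> disjoint_family I \<and>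
     (\<forall>n. lc_interval (c n) (d n) (J n)) \<and> disjoint_family J \<and>
     (\<Union>n. I n) \<subseteq> A \<and> A \<subseteq> (\<Union>n. J n) \<and>
     strongly_sums (\<lambda>n. b n - a n) s \<and> strongly_sums (\<lambda>n. d n - c n) t \<and>
     t - s \<le> \<epsilon>)"

end

theory Submission
  imports Defs "HOL-Analysis.Continuum_Not_Denumerable"
begin

text \<open>
  Write \<open>d\<close> for the infinitesimal \<open>lc_monom 1 1\<close>. If countably many intervals with strongly
  summable lengths cover all points \<open>x + r d\<^sup>p\<close> with \<open>r > 0\<close> real, then their total length
  is infinitely larger than \<open>d\<^sup>p\<close>: otherwise only finitely many lengths are not infinitesimal
  relative to \<open>d\<^sup>p\<close>, these finitely many intervals catch a bounded set of parameters \<open>r\<close>, and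
  each of the others catches at most one \<open>r\<close>, which contradicts the uncountability of the reals.

  Since the total length is a single element of the field, the sets \<open>\<lambda>(x - y) < q\<close> and
  \<open>\<lambda>(x - y) \<le> q\<close> have no such cover at all. The other three sets are contained in
  a translate of a convex subgroup \<open>H\<close> (the elements with \<open>\<lambda> > q\<close> or \<open>\<lambda> \<ge> q\<close>). Disjoint intervals
  inside have lengths in \<open>H\<close>, hence so is their sum, and by measurability the total length of some
  cover lies in \<open>H\<close> as well, which is too small.
\<close>

section \<open>Leading exponents, order and coefficients\<close>

lemma coeff_lc_monom [simp]: "coeff (lc_monom c p) q = (if q = p then c else 0)"
  by (simp add: lc_monom.rep_eq)

lemma Fin_le_lambda_iff: "Fin q \<le> lambda y \<longleftrightarrow> (\<forall>p<q. coeff y p = 0)"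
proof (cases "y = 0")
  case False
  then obtain m where "lambda y = Fin m" using lambda_cases by blast
  then show ?thesis using lambda_eq_Fin_iff[of y m] by (auto intro: leI)
qed simp

lemma Fin_less_lambda_iff: "Fin q < lambda y \<longleftrightarrow> (\<forall>p\<le>q. coeff y p = 0)"
proof (cases "y = 0")
  case False
  then obtain m where "lambda y = Fin m" using lambda_cases by blast
  then show ?thesis using lambda_eq_Fin_iff[of y m] less_extended_simps(1) le_less_trans not_less by metis
qed simp

text \<open>Left-finite sets have no accumulation at \<open>q\<close> from the right, so vanishing
  up to and including \<open>q\<close> extends strictly beyond it.\<close>

lemma left_finite_gap_right:
  assumes "left_finite F" "\<And>p. p \<le> q \<Longrightarrow> p \<notin> F"
  shows "\<exists>r>q. \<forall>p<r. p \<notin> F"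
proof (cases "F = {}")
  case True
  then show ?thesis by (intro exI[of _ "q + 1"]) simp
next
  case False
  with left_finite_min[OF assms(1)] obtain m where "m \<in> F" "\<forall>p\<in>F. m \<le> p" by blast
  moreover from this assms(2) have "q < m" by (meson not_less)
  ultimately show ?thesis by (intro exI[of _ m]) force
qed

lemma lc_monom_pos: "0 < c \<Longrightarrow> 0 < lc_monom c p"
  by (auto simp: less_levi_civita_def lc_neg_def lambda_eq_Fin_iff)

lemma lc_less_by_coeff:
  assumes "\<And>a. a < p \<Longrightarrow> coeff y a = coeff z a" "coeff y p < coeff z p"
  shows "y < z"
  using assms by (auto simp: less_levi_civita_def lc_neg_def lambda_eq_Fin_iff intro!: exI[of _ p])

lemma coeff_le_coeff:
  assumes "y \<le> z" "\<And>a. a < p \<Longrightarrow> coeff y a = coeff z a"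
  shows "coeff y p \<le> coeff z p"
  using lc_less_by_coeff[of p z y] assms by force

text \<open>If the leading exponent \<open>m\<close> of \<open>y\<close> were at most
  \<open>p\<close>, then \<open>z\<close> would vanish up to \<open>m\<close>, and comparing
  \<open>0\<close>, \<open>y\<close>, \<open>z\<close> at \<open>m\<close> would force
  \<open>coeff y m = 0\<close>.\<close>

lemma coeff_zero_convex:
  assumes "0 \<le> y" "y \<le> z" and z: "\<And>a. a \<le> p \<Longrightarrow> coeff z a = 0"
  shows "coeff y p = 0"
proof (rule ccontr)
  assume p: "coeff y p \<noteq> 0"
  then obtain m where m: "lambda y = Fin m" using lambda_cases[of y] by auto
  then have c: "coeff y m \<noteq> 0" "\<And>a. a < m \<Longrightarrow> coeff y a = 0"
    by (simp_all add: lambda_eq_Fin_iff)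
  with p have "m \<le> p" using not_less by blast
  then have "coeff z m = 0" "\<And>a. a < m \<Longrightarrow> coeff z a = 0" using z by simp_all
  with coeff_le_coeff[of 0 y m] coeff_le_coeff[of y z m] c assms(1,2) show False by simp
qed

section \<open>Strong limits read coefficientwise\<close>

lemma strongly_converges_coeff:
  assumes "strongly_converges a l"
  shows "\<exists>N. \<forall>n\<ge>N. \<forall>q\<le>p. coeff (a n) q = coeff l q"
proof -
  \<comment> \<open>Exponent \<open>p + 1\<close> makes the tolerance vanish up to and including
    \<open>p\<close>; by convexity the error does too.\<close>
  obtain N where N: "\<And>n. n \<ge> N \<Longrightarrow> \<bar>a n - l\<bar> < lc_monom 1 (p + 1)"
    using assms lc_monom_pos[of 1] unfolding strongly_converges_def by (meson zero_less_one)
  have "coeff (a n) q = coeff l q" if "n \<ge> N" "q \<le> p" for n q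
  proof -
    have "coeff \<bar>a n - l\<bar> q = 0"
      by (rule coeff_zero_convex[OF _ less_imp_le[OF N[OF that(1)]]]) (use that in auto)
    then show ?thesis by (simp add: abs_levi_civita_def split: if_splits)
  qed
  then show ?thesis by blast
qed

lemma strongly_sums_coeff_zero:
  assumes "strongly_sums a s" "\<And>n. coeff (a n) q = 0"
  shows "coeff s q = 0"
proof -
  obtain N where "\<forall>n\<ge>N. \<forall>p\<le>q. coeff (\<Sum>k<n. a k) p = coeff s p"
    using strongly_converges_coeff assms(1) unfolding strongly_sums_def by blast
  then have "coeff (\<Sum>k<N. a k) q = coeff s q" by blast
  with assms(2) show ?thesis by simp
qed

lemma strongly_sums_eventually_coeff_zero:
  assumes "strongly_sums a s"
  shows "\<exists>N. \<forall>n\<ge>N. coeff (a n) q = 0"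
proof -
  obtain N where N: "\<forall>n\<ge>N. \<forall>p\<le>q. coeff (\<Sum>k<n. a k) p = coeff s p"
    using strongly_converges_coeff assms unfolding strongly_sums_def by blast
  have "coeff (a n) q = 0" if "n \<ge> N" for n
  proof -
    have "coeff (\<Sum>k<Suc n. a k) q = coeff s q" "coeff (\<Sum>k<n. a k) q = coeff s q"
      using N that by (blast intro: le_SucI)+
    then show ?thesis by simp
  qed
  then show ?thesis by blast
qed

text \<open>Every partial sum past index \<open>n\<close> is at least \<open>a n\<close>, so the
  sums cannot approach a smaller limit.\<close>

lemma strongly_sums_ge_term:
  assumes "strongly_sums a s" "\<And>k. 0 \<le> a k"
  shows "a n \<le> s"
proof (rule ccontr)
  assume "\<not> a n \<le> s"
  then have "0 < a n - s" by simp
  then obtain N where N: "\<And>m. m \<ge> N \<Longrightarrow> \<bar>(\<Sum>k<m. a k) - s\<bar> < a n - s"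
    using assms(1) unfolding strongly_sums_def strongly_converges_def by blast
  define m where "m = max N (Suc n)"
  have "a n \<le> (\<Sum>k<m. a k)"
    by (rule member_le_sum) (use assms(2) in \<open>auto simp: m_def\<close>)
  moreover have "(\<Sum>k<m. a k) - s < a n - s"
    using N[of m] by (simp add: m_def abs_less_iff)
  ultimately show False by simp
qed

section \<open>Interval lengths\<close>

lemma lc_interval_diff_le:
  assumes "lc_interval a b I" "y \<in> I" "z \<in> I"
  shows "z - y \<le> b - a"
  using assms by (auto simp: lc_interval_def intro!: diff_mono)

text \<open>A nondegenerate interval of any of the four kinds has two interior points one third of
  its length apart, so the length is three times a difference of points of \<open>I\<close>.\<close>

lemma lc_interval_length_coeff_zero:
  assumes I: "lc_interval a b I"
    and zero: "\<And>y p. y \<in> I \<Longrightarrow> p \<in> D \<Longrightarrow> coeff (x - y) p = 0" and "p \<in> D"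
  shows "coeff (b - a) p = 0"
proof (cases "a = b")
  case False
  define h where "h = (b - a) / 3"
  have b: "b = a + (h + h + h)" by (simp add: h_def field_simps)
  have "a < b" using I False by (auto simp: lc_interval_def)
  then have h: "0 < h" by (simp add: h_def)
  have "a < a + h" "a + h < b" "a < a + (h + h)" "a + (h + h) < b"
    using h by (simp_all add: b)
  then have "a + h \<in> I" "a + (h + h) \<in> I"
    using I by (auto simp: lc_interval_def)
  from zero[OF this(1) \<open>p \<in> D\<close>] zero[OF this(2) \<open>p \<in> D\<close>]
  have "coeff ((x - (a + h)) - (x - (a + (h + h)))) p = 0" by (simp only: coeff_simps diff_self)
  moreover have "(x - (a + h)) - (x - (a + (h + h))) = h" by (simp add: algebra_simps)
  ultimately have "coeff h p = 0" by simp
  then show ?thesis unfolding b coeff_simps by simp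
qed simp

lemma cover_length_coeff_nonzero:
  assumes J: "\<And>n. lc_interval (c n) (d n) (J n)"
    and t: "strongly_sums (\<lambda>n. d n - c n) t"
    and cover: "\<And>r. 0 < r \<Longrightarrow> x + lc_monom r p \<in> (\<Union>n. J n)"
  shows "\<exists>a<p. coeff t a \<noteq> 0"
proof (rule ccontr)
  assume "\<not> ?thesis"
  then have t0: "\<And>a. a < p \<Longrightarrow> coeff t a = 0" by blast
  define L where "L n = d n - c n" for n
  have L_nonneg: "0 \<le> L n" for n using J[of n] by (simp add: L_def lc_interval_def)
  have L_le: "L n \<le> t" for n
    using strongly_sums_ge_term[of L t n] t L_nonneg by (simp add: L_def[abs_def])
  have L0: "coeff (L n) a = 0" if "a < p" for n a
    by (rule coeff_zero_convex[OF L_nonneg L_le]) (use t0 that in auto)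
  obtain N where N: "\<And>n. n \<ge> N \<Longrightarrow> coeff (L n) p = 0"
    using strongly_sums_eventually_coeff_zero t unfolding L_def by blast
  define R where "R n = {r. 0 < r \<and> x + lc_monom r p \<in> J n}" for n
  have diff: "r' - r \<le> coeff (L n) p" if "r \<in> R n" "r' \<in> R n" for n r r'
  proof -
    let ?y = "(x + lc_monom r' p) - (x + lc_monom r p)"
    have "?y \<le> L n"
      unfolding L_def by (rule lc_interval_diff_le[OF J]) (use that in \<open>simp_all add: R_def\<close>)
    \<comment> \<open>Below \<open>p\<close> both \<open>?y\<close> and \<open>L n\<close> vanish,
      so their order is passed on to the coefficients at \<open>p\<close>.\<close>
    then have "coeff ?y p \<le> coeff (L n) p" by (rule coeff_le_coeff) (use L0 in auto)
    then show ?thesis by simp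
  qed
  have bdd: "bdd_above (R n)" for n
  proof (cases "R n = {}")
    case False
    then obtain r where r: "r \<in> R n" by blast
    show ?thesis
      by (rule bdd_aboveI[of _ "coeff (L n) p + r"]) (use diff[OF r] in \<open>simp add: diff_le_eq\<close>)
  qed simp
  have "bdd_above (\<Union>n<N. R n)" using bdd by simp
  then obtain B where B: "\<And>r. r \<in> (\<Union>n<N. R n) \<Longrightarrow> r \<le> B" unfolding bdd_above_def by blast
  have cnt: "countable (R n)" if n: "n \<ge> N" for n
  proof -
    have "r = r'" if "r \<in> R n" "r' \<in> R n" for r r'
      using diff[OF that] diff[OF that(2,1)] N[OF n] by simp
    then have "R n = {} \<or> (\<exists>r. R n = {r})" by blast
    then show ?thesis by auto
  qed
  \<comment> \<open>Parameters above \<open>M\<close> are positive and out of reach of the first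
    \<open>N\<close> intervals.\<close>
  define M where "M = max B 0"
  have "{M<..<M + 1} \<subseteq> (\<Union>n\<in>{N..}. R n)"
  proof
    fix r assume r: "r \<in> {M<..<M + 1}"
    then have "0 < r" by (simp add: M_def)
    with cover obtain n where n: "r \<in> R n" unfolding R_def by blast
    have "n \<ge> N"
    proof (rule ccontr)
      assume "\<not> n \<ge> N"
      with n have "r \<le> B" by (intro B) auto
      with r show False by (simp add: M_def)
    qed
    with n show "r \<in> (\<Union>n\<in>{N..}. R n)" by blast
  qed
  moreover have "countable (\<Union>n\<in>{N..}. R n)" using cnt by (intro countable_UN) auto
  ultimately have "countable {M<..<M + 1}" using countable_subset by blast
  then show False using uncountable_open_interval[of M "M + 1"] by simp
qed

section \<open>Non-measurability\<close>

lemma lc_measurableE: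
  assumes "lc_measurable A" "0 < \<epsilon>"
  obtains a b I c d J s t where
    "\<And>n. lc_interval (a n) (b n) (I n)" "(\<Union>n. I n) \<subseteq> A" "strongly_sums (\<lambda>n. b n - a n) s"
    "\<And>n. lc_interval (c n) (d n) (J n)" "A \<subseteq> (\<Union>n. J n)" "strongly_sums (\<lambda>n. d n - c n) t"
    "t - s \<le> \<epsilon>"
  using assms(1)[unfolded lc_measurable_def, rule_format, OF assms(2)]
  by (elim exE conjE) (rule that, (erule spec | assumption)+)

lemma not_measurable_unbounded:
  assumes "\<And>p r. p < q \<Longrightarrow> 0 < r \<Longrightarrow> x + lc_monom r p \<in> A"
  shows "\<not> lc_measurable A"
proof
  assume "lc_measurable A"
  then obtain c d J t where J: "\<And>n. lc_interval (c n) (d n) (J n)" "A \<subseteq> (\<Union>n. J n)"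
      "strongly_sums (\<lambda>n. d n - c n) t"
    by (rule lc_measurableE[OF _ zero_less_one]) (rule that)
  obtain m where m: "\<And>a. coeff t a \<noteq> 0 \<Longrightarrow> m \<le> a"
    using left_finite_bdd[OF left_finite_supp[of t]] by blast
  \<comment> \<open>The support of \<open>t\<close> starts no earlier than \<open>p\<close>, and
    \<open>q - 1\<close> keeps \<open>p\<close> strictly below \<open>q\<close>.\<close>
  define p where "p = min m (q - 1)"
  have "p < q" by (simp add: p_def)
  have "\<exists>a<p. coeff t a \<noteq> 0"
    by (rule cover_length_coeff_nonzero[OF J(1,3)]) (use assms[OF \<open>p < q\<close>] J(2) in blast)
  then obtain a where "a < p" "coeff t a \<noteq> 0" by blast
  with m[of a] show False by (simp add: p_def)
qed

text \<open>
  The set \<open>D\<close> below is a proper initial segment of the rationals and encodes the convex subgroup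
  of all elements whose coefficients vanish on \<open>D\<close>.
\<close>

lemma measurable_small_cover:
  assumes A: "lc_measurable A" and D: "\<And>a b. a \<le> b \<Longrightarrow> b \<in> D \<Longrightarrow> a \<in> D" and "r \<notin> D"
    and zero: "\<And>y p. y \<in> A \<Longrightarrow> p \<in> D \<Longrightarrow> coeff (x - y) p = 0"
  obtains c d J t where "\<And>n. lc_interval (c n) (d n) (J n)" "A \<subseteq> (\<Union>n. J n)"
    "strongly_sums (\<lambda>n. d n - c n) t" "\<And>p. p \<in> D \<Longrightarrow> coeff t p = 0"
proof -
  obtain a b I c d J s t where I: "\<And>n. lc_interval (a n) (b n) (I n)" "(\<Union>n. I n) \<subseteq> A"
      "strongly_sums (\<lambda>n. b n - a n) s"
    and J: "\<And>n. lc_interval (c n) (d n) (J n)" "A \<subseteq> (\<Union>n. J n)"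
      "strongly_sums (\<lambda>n. d n - c n) t"
    \<comment> \<open>As \<open>r\<close> lies outside \<open>D\<close>, this tolerance belongs to
      the subgroup, so \<open>t\<close> lies in it once \<open>s\<close> does.\<close>
    and ts: "t - s \<le> lc_monom 1 r"
    by (rule lc_measurableE[OF A lc_monom_pos[OF zero_less_one, of r]]) (rule that)
  have s0: "coeff s p = 0" if "p \<in> D" for p
  proof (rule strongly_sums_coeff_zero[OF I(3)])
    show "coeff (b n - a n) p = 0" for n
      by (rule lc_interval_length_coeff_zero[OF I(1) _ that]) (use zero I(2) in blast)
  qed
  have nonneg: "0 \<le> d n - c n" for n using J(1)[of n] by (simp add: lc_interval_def)
  have "0 \<le> t" using nonneg strongly_sums_ge_term[OF J(3) nonneg] by (rule order_trans)
  moreover have "t \<le> lc_monom 1 r + s" using ts by (simp add: diff_le_eq)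
  ultimately have "coeff t p = 0" if "p \<in> D" for p
    by (rule coeff_zero_convex) (use s0 D that \<open>r \<notin> D\<close> in auto)
  with J show thesis by (rule that)
qed

text \<open>Serves the closed ball and the sphere, which both contain points at exponent
  \<open>q\<close> itself.\<close>

lemma not_measurable_in_ball:
  assumes zero: "\<And>y. y \<in> A \<Longrightarrow> Fin q \<le> lambda (x - y)"
    and points: "\<And>r. 0 < r \<Longrightarrow> x + lc_monom r q \<in> A"
  shows "\<not> lc_measurable A"
proof
  assume A: "lc_measurable A"
  obtain c d J t where J: "\<And>n. lc_interval (c n) (d n) (J n)" "A \<subseteq> (\<Union>n. J n)"
    "strongly_sums (\<lambda>n. d n - c n) t" "\<And>p. p \<in> {..<q} \<Longrightarrow> coeff t p = 0"
    by (rule measurable_small_cover[OF A, of "{..<q}" q x])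
       (use zero in \<open>auto simp: Fin_le_lambda_iff\<close>)
  have "\<exists>a<q. coeff t a \<noteq> 0"
    by (rule cover_length_coeff_nonzero[OF J(1,3)]) (use points J(2) in blast)
  with J(4) show False by auto
qed

lemma not_measurable_open_ball: "\<not> lc_measurable {y. Fin q < lambda (x - y)}" (is "\<not> lc_measurable ?A")
proof
  assume A: "lc_measurable ?A"
  obtain c d J t where J: "\<And>n. lc_interval (c n) (d n) (J n)" "?A \<subseteq> (\<Union>n. J n)"
    "strongly_sums (\<lambda>n. d n - c n) t" "\<And>p. p \<in> {..q} \<Longrightarrow> coeff t p = 0"
    by (rule measurable_small_cover[OF A, of "{..q}" "q + 1" x]) (auto simp: Fin_less_lambda_iff)
  \<comment> \<open>The open ball has no points at exponent \<open>q\<close>; a larger exponent is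
    taken from the gap in the support of \<open>t\<close>.\<close>
  obtain p where p: "q < p" "\<And>a. a < p \<Longrightarrow> coeff t a = 0"
    using left_finite_gap_right[OF left_finite_supp[of t], of q] J(4) by auto
  have "\<exists>a<p. coeff t a \<noteq> 0"
  proof (rule cover_length_coeff_nonzero[OF J(1,3)])
    fix r :: real
    have "x + lc_monom r p \<in> ?A" using p(1) by (auto simp: Fin_less_lambda_iff)
    with J(2) show "x + lc_monom r p \<in> (\<Union>n. J n)" by blast
  qed
  with p(2) show False by blast
qed

theorem lemma3p5:
  fixes x :: levi_civita and q :: rat
  shows "\<not> lc_measurable {y. lambda (x - y) > Fin q} \<and>
    \<not> lc_measurable {y. lambda (x - y) \<ge> Fin q} \<and>
    \<not> lc_measurable {y. lambda (x - y) < Fin q} \<and>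
    \<not> lc_measurable {y. lambda (x - y) \<le> Fin q} \<and>
    \<not> lc_measurable {y. lambda (x - y) = Fin q}"
proof (intro conjI)
  have l: "lambda (x - (x + lc_monom r p)) = Fin p" if "0 < r" for r p
    using that by (simp add: lambda_eq_Fin_iff)
  show "\<not> lc_measurable {y. lambda (x - y) > Fin q}" by (rule not_measurable_open_ball)
  show "\<not> lc_measurable {y. lambda (x - y) \<ge> Fin q}"
    by (rule not_measurable_in_ball[where q = q and x = x]) (simp_all only: l mem_Collect_eq order_refl)
  show "\<not> lc_measurable {y. lambda (x - y) = Fin q}"
    by (rule not_measurable_in_ball[where q = q and x = x]) (simp_all only: l mem_Collect_eq order_refl)
  show "\<not> lc_measurable {y. lambda (x - y) < Fin q}"
    by (rule not_measurable_unbounded[where q = q and x = x]) (simp only: l mem_Collect_eq less_extended_simps)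
  show "\<not> lc_measurable {y. lambda (x - y) \<le> Fin q}"
    by (rule not_measurable_unbounded[where q = q and x = x]) (simp only: l mem_Collect_eq less_eq_extended.simps less_imp_le)
qed

end
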